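(* Let $q$ be an odd prime power with $q\equiv 1\pmod 3$, let $m=(q-1)/3$, and let $\gamma$ be a generator of the multiplicative group $\mathbf{F}_q^*$. For each $k\in\{0,1,\dots,m-1\}$, define elements $a,b,c\in\mathbf{F}_q$ by $$a=\frac{\gamma^{2m}+\gamma^{m+6k+2}+\gamma^{3k+1}}{3\gamma^{m+3k+1}},\qquad b=\frac{\gamma^{2m+3k+1}+\gamma^{m+6k+2}+1}{3\gamma^{m+3k+1}},\qquad c=\frac{\gamma^{6k+2}+\gamma^{3k+1}+1}{3\gamma^{3k+1}}.$$ Then the polynomial $g(x)=ax^{2m+1}+bx^{m+1}+cx$ is a permutation polynomial over $\mathbf{F}_q$, and the permutation of $\mathbf{F}_q$ it induces is an involution with exactly $m+1$ fixed points.
   Context: $\mathbf{F}_q$ denotes the finite field with $q$ elements. A permutation polynomial over $\mathbf{F}_q$ is a polynomial $g\in\mathbf{F}_q[x]$ whose associated map $\mathbf{F}_q\to\mathbf{F}_q$, $x\mapsto g(x)$, is a bijection; it is involutory if $g(g(x))=x$ for all $x\in\mathbf{F}_q$. *)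

theory Defs
  imports
    "HOL-Computational_Algebra.Polynomial"
    "HOL-Library.Cardinality"
    "HOL-Number_Theory.Cong"
    "HOL-Number_Theory.Prime_Powers"
begin

definition mult_generator :: "'a::field \<Rightarrow> bool" where
  "mult_generator \<gamma> \<longleftrightarrow> range (\<lambda>i::int. \<gamma> powi i) = UNIV - {0}"

definition permutation_poly :: "'a::{field,finite} poly \<Rightarrow> bool" where
  "permutation_poly g \<longleftrightarrow> bij (poly g)"

definition involutory_poly :: "'a::{field,finite} poly \<Rightarrow> bool" where
  "involutory_poly g \<longleftrightarrow> (\<forall>x. poly g (poly g x) = x)"

end

theory Submission imports Defs begin

text \<open>Put \<open>w = \<gamma> ^ m\<close>, a primitive cube root of unity, and \<open>u = \<gamma> ^ (3 * k + 1)\<close>, so \<open>u ^ m = w\<close>.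
  Then \<open>g x = x * h (x ^ m)\<close> where \<open>h z = a * z\<^sup>2 + b * z + c\<close> is the quadratic interpolating
  \<open>h 1 = u\<close>, \<open>h w = 1 / u\<close>, \<open>h (w\<^sup>2) = 1\<close>. Hence \<open>g\<close> maps the coset \<open>x ^ m = 1\<close> to the coset \<open>x ^ m = w\<close>
  by multiplication with \<open>u\<close>, maps the latter back by division by \<open>u\<close>, and fixes \<open>0\<close> together with
  the \<open>m\<close> elements of the coset \<open>x ^ m = w\<^sup>2\<close>.\<close>

text \<open>Multiplication by \<open>x\<close> permutes the nonzero elements, so it leaves their
  product unchanged while also scaling it by \<open>x ^ (CARD('a) - 1)\<close>.\<close>

lemma finite_field_power_card_minus_1:
  fixes x :: "'a::{field,finite}"
  assumes "x \<noteq> 0"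
  shows "x ^ (CARD('a) - 1) = 1"
proof -
  let ?S = "UNIV - {0::'a}"
  have "bij_betw ((*) x) ?S ?S"
    by (rule bij_betwI[where g = "\<lambda>y. y / x"]) (use assms in auto)
  then have "\<Prod>?S = (\<Prod>y\<in>?S. x * y)"
    using prod.reindex_bij_betw[of "(*) x" ?S ?S "\<lambda>y. y"] by simp
  also have "\<dots> = x ^ (CARD('a) - 1) * \<Prod>?S"
    by (simp add: prod.distrib card_Diff_singleton)
  finally show ?thesis
    by simp
qed

lemma mult_generator_nonzero:
  assumes "mult_generator (\<gamma> :: 'a::field)"
  shows "\<gamma> \<noteq> 0"
proof -
  have "\<gamma> powi 1 \<in> UNIV - {0}"
    using assms unfolding mult_generator_def by blast
  then show ?thesis by simp
qed

text \<open>With \<open>n = CARD('a) - 1\<close>, the relation \<open>\<gamma> ^ n = 1\<close>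
  reduces integer exponents modulo \<open>n\<close>. The resulting surjection between two sets of
  size \<open>n\<close> must be injective.\<close>

lemma mult_generator_bij_betw:
  fixes \<gamma> :: "'a::{field,finite}"
  assumes "mult_generator \<gamma>"
  shows "bij_betw (\<lambda>i. \<gamma> ^ i) {..<CARD('a) - 1} (UNIV - {0})"
proof -
  define n where "n = CARD('a) - 1"
  have nz: "\<gamma> \<noteq> 0"
    by (rule mult_generator_nonzero[OF assms])
  \<comment> \<open>The distinct elements 0 and 1 make \<open>n\<close> positive, so remainders
    modulo \<open>n\<close> lie in \<open>{..<n}\<close>.\<close>
  have "{0, 1 :: 'a} \<subseteq> UNIV" by simp
  then have "card {0, 1 :: 'a} \<le> CARD('a)"
    by (intro card_mono) auto
  then have n: "n > 0" by (simp add: n_def)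
  have one: "\<gamma> powi (int n) = 1"
    using finite_field_power_card_minus_1[OF nz] unfolding n_def[symmetric] by simp
  have image: "(\<lambda>i. \<gamma> ^ i) ` {..<n} = UNIV - {0}"
  proof (intro equalityI subsetI)
    fix x assume "x \<in> UNIV - {0 :: 'a}"
    then obtain i :: int where i: "x = \<gamma> powi i"
      using assms unfolding mult_generator_def by blast
    have "\<gamma> powi i = \<gamma> powi (int n * (i div int n) + i mod int n)"
      by simp
    also have "\<dots> = \<gamma> powi (i mod int n)"
      using nz one power_int_mult[of \<gamma> "int n" "i div int n"]
      by (subst power_int_add) auto
    also have "\<dots> = \<gamma> ^ nat (i mod int n)"
      using n by (simp add: power_int_def)
    finally show "x \<in> (\<lambda>i. \<gamma> ^ i) ` {..<n}"
      using i n by (auto simp: nat_less_iff intro!: imageI)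
  qed (use nz in auto)
  then have "card ((\<lambda>i. \<gamma> ^ i) ` {..<n}) = card {..<n}"
    by (simp add: n_def card_Diff_singleton)
  then have "inj_on (\<lambda>i. \<gamma> ^ i) {..<n}"
    by (intro eq_card_imp_inj_on) auto
  with image show ?thesis
    by (simp add: bij_betw_def n_def)
qed

text \<open>The sum is the cofactor of \<open>w - 1\<close> in \<open>w ^ 3 - 1\<close>. In
  characteristic 3 it would equal \<open>(w - 1)\<^sup>2\<close>, forcing \<open>w = 1\<close>;
  hence the denominators of \<open>a\<close>, \<open>b\<close>, \<open>c\<close> do not
  vanish.\<close>

lemma cube_root_of_unity_sum:
  fixes w :: "'a::field"
  assumes "w ^ 3 = 1" "w \<noteq> 1"
  shows "1 + w + w\<^sup>2 = 0" "(3 :: 'a) \<noteq> 0"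
proof -
  have "(w - 1) * (1 + w + w\<^sup>2) = w ^ 3 - 1"
    by (simp add: algebra_simps power2_eq_square power3_eq_cube)
  with assms show *: "1 + w + w\<^sup>2 = 0" by simp
  show "(3 :: 'a) \<noteq> 0"
  proof
    assume "(3 :: 'a) = 0"
    moreover have "(w - 1)\<^sup>2 = (1 + w + w\<^sup>2) - 3 * w"
      by (simp add: algebra_simps power2_eq_square)
    ultimately have "(w - 1)\<^sup>2 = 0" using * by simp
    with assms show False by simp
  qed
qed

text \<open>The coefficients are the inverse discrete Fourier transform over the cube roots of unity
  of the values \<open>u\<close>, \<open>1 / u\<close>, \<open>1\<close>. After multiplication by
  \<open>3 * (w * u)\<close>, the two sides of each identity differ by a combination of
  \<open>1 + w + w\<^sup>2\<close> and \<open>w ^ 3 - 1\<close>, both zero.\<close>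

lemma interpolating_quadratic_values:
  fixes w u :: "'a::field"
  assumes w: "w ^ 3 = 1" "w \<noteq> 1" and u: "u \<noteq> 0"
    and a: "a = (w\<^sup>2 + w * u\<^sup>2 + u) / (3 * (w * u))"
    and b: "b = (w\<^sup>2 * u + w * u\<^sup>2 + 1) / (3 * (w * u))"
    and c: "c = (u\<^sup>2 + u + 1) / (3 * u)"
  shows "a + b + c = u" "a * w\<^sup>2 + b * w + c = 1 / u" "a * (w\<^sup>2)\<^sup>2 + b * w\<^sup>2 + c = 1"
proof -
  note s = cube_root_of_unity_sum[OF w]
  have w0: "w \<noteq> 0" using w by auto
  have D: "3 * (w * u) \<noteq> 0" using s(2) w0 u by simp
  have A: "3 * (w * u) * a = w\<^sup>2 + w * u\<^sup>2 + u" and B: "3 * (w * u) * b = w\<^sup>2 * u + w * u\<^sup>2 + 1"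
    and C: "3 * (w * u) * c = w * (u\<^sup>2 + u + 1)"
    using D by (simp_all add: a b c)
  have "3 * (w * u) * (a + b + c) = 3 * (w * u) * a + 3 * (w * u) * b + 3 * (w * u) * c"
    by (simp add: distrib_left)
  also have "\<dots> = 3 * (w * u) * u + (1 + u) * (1 + w + w\<^sup>2)"
    unfolding A B C by (simp add: algebra_simps power2_eq_square)
  finally show "a + b + c = u" using D s(1) by simp
  have "3 * (w * u) * (a * w\<^sup>2 + b * w + c)
      = 3 * (w * u) * a * w\<^sup>2 + 3 * (w * u) * b * w + 3 * (w * u) * c"
    by (simp add: distrib_left)
  also have "\<dots> = 3 * w + (w ^ 3 - 1) * (w + u\<^sup>2 + u) + (u\<^sup>2 + u) * (1 + w + w\<^sup>2)"
    unfolding A B C by (simp add: algebra_simps power2_eq_square power3_eq_cube)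
  also have "\<dots> = 3 * (w * u) * (1 / u)"
    using w(1) s(1) u by simp
  finally show "a * w\<^sup>2 + b * w + c = 1 / u" using D mult_cancel_left by blast
  have "3 * (w * u) * (a * (w\<^sup>2)\<^sup>2 + b * w\<^sup>2 + c)
      = 3 * (w * u) * a * (w\<^sup>2)\<^sup>2 + 3 * (w * u) * b * w\<^sup>2 + 3 * (w * u) * c"
    by (simp add: distrib_left)
  also have "\<dots> = 3 * (w * u) * 1 + (w ^ 3 - 1) * (w ^ 3 + 1 + w\<^sup>2 * u\<^sup>2 + 2 * w * u + u\<^sup>2)
      + (1 + u\<^sup>2) * (1 + w + w\<^sup>2)"
    unfolding A B C by (simp add: algebra_simps power2_eq_square power3_eq_cube)
  finally show "a * (w\<^sup>2)\<^sup>2 + b * w\<^sup>2 + c = 1" using D w(1) s(1) by simp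
qed

theorem theorem2p3:
  fixes q m k :: nat and \<gamma> a b c :: "'a::{field,finite}" and g :: "'a poly"
  assumes "q = CARD('a)" and "primepow q" and "odd q" and "[q = 1] (mod 3)"
    and "m = (q - 1) div 3"
    and "mult_generator \<gamma>"
    and "k \<in> {0..<m}"
    and "a = (\<gamma> ^ (2*m) + \<gamma> ^ (m + 6*k + 2) + \<gamma> ^ (3*k + 1)) / (3 * \<gamma> ^ (m + 3*k + 1))"
    and "b = (\<gamma> ^ (2*m + 3*k + 1) + \<gamma> ^ (m + 6*k + 2) + 1) / (3 * \<gamma> ^ (m + 3*k + 1))"
    and "c = (\<gamma> ^ (6*k + 2) + \<gamma> ^ (3*k + 1) + 1) / (3 * \<gamma> ^ (3*k + 1))"
    and "g = monom a (2*m + 1) + monom b (m + 1) + monom c 1"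
  shows "permutation_poly g \<and> involutory_poly g \<and> card {x. poly g x = x} = m + 1"
proof -
  define w where "w = \<gamma> ^ m"
  define u where "u = \<gamma> ^ (3*k + 1)"
  have m: "m > 0" using assms(7) by simp
  have "q mod 3 = 1" using assms(4) by (simp add: cong_def)
  then have q: "CARD('a) - 1 = 3 * m"
    using assms(1,5) by presburger
  note bij = mult_generator_bij_betw[OF assms(6), unfolded q]
  have g0: "\<gamma> \<noteq> 0" by (rule mult_generator_nonzero[OF assms(6)])
  have w3: "w ^ 3 = 1"
    using finite_field_power_card_minus_1[OF g0] unfolding q w_def
    by (simp add: power_mult[symmetric] mult.commute)
  \<comment> \<open>The exponents \<open>m\<close> and \<open>0\<close> are distinct and both below
    \<open>3 * m\<close>.\<close>
  have w1: "w \<noteq> 1"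
    using inj_onD[OF bij_betw_imp_inj_on[OF bij], of m 0] m by (auto simp: w_def)
  have u0: "u \<noteq> 0" using g0 by (simp add: u_def)
  have w_pow: "w ^ i = w ^ (i mod 3)" for i
  proof -
    have "w ^ i = w ^ (3 * (i div 3) + i mod 3)" by simp
    also have "\<dots> = w ^ (i mod 3)"
      using w3 by (simp only: power_add power_mult) simp
    finally show ?thesis .
  qed
  have gamma_pow: "(\<gamma> ^ i) ^ m = w ^ (i mod 3)" for i
    by (subst w_pow[symmetric]) (simp add: w_def power_mult[symmetric] mult.commute)
  \<comment> \<open>The exponent of \<open>u\<close> is 1 modulo 3, so multiplication by
    \<open>u\<close> carries the coset of 1 to the coset of \<open>w\<close>.\<close>
  have um: "u ^ m = w"
    unfolding u_def gamma_pow by (simp add: mod_Suc)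
  have w2: "w\<^sup>2 \<noteq> 1" "w\<^sup>2 \<noteq> w"
    using w3 w1 by (auto simp: power2_eq_square power3_eq_cube)
  \<comment> \<open>This excludes nonzero fixed points in the two cosets that are swapped.\<close>
  have u1: "u \<noteq> 1" using um w1 by auto

  have exps: "\<gamma> ^ (2*m) = w\<^sup>2" "\<gamma> ^ (m + 6*k + 2) = w * u\<^sup>2" "\<gamma> ^ (m + 3*k + 1) = w * u"
    "\<gamma> ^ (2*m + 3*k + 1) = w\<^sup>2 * u" "\<gamma> ^ (6*k + 2) = u\<^sup>2"
    by (simp_all add: w_def u_def power_add[symmetric] power_mult[symmetric] algebra_simps
        flip: power_Suc power_Suc2)
  note h = interpolating_quadratic_values[OF w3 w1 u0
      assms(8)[unfolded exps, folded u_def] assms(9)[unfolded exps] assms(10)[unfolded exps, folded u_def]]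

  have g: "poly g x = x * (a * (x ^ m)\<^sup>2 + b * x ^ m + c)" for x
    by (simp add: assms(11) poly_monom algebra_simps power_mult power_add mult_2 power2_eq_square)
  \<comment> \<open>The coset of \<open>\<gamma> ^ i\<close> is determined by
    \<open>i mod 3\<close>.\<close>
  have cosets: "x = 0 \<or> x ^ m = 1 \<or> x ^ m = w \<or> x ^ m = w\<^sup>2" for x
  proof (cases "x = 0")
    case False
    then obtain i where i: "x = \<gamma> ^ i"
      using bij_betw_imp_surj_on[OF bij] by blast
    have "i mod 3 = 0 \<or> i mod 3 = 1 \<or> i mod 3 = 2" by linarith
    then show ?thesis using gamma_pow[of i] i by (elim disjE) simp_all
  qed simp
  have v: "poly g 0 = 0" "x ^ m = 1 \<Longrightarrow> poly g x = x * u" "x ^ m = w \<Longrightarrow> poly g x = x / u"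
    "x ^ m = w\<^sup>2 \<Longrightarrow> poly g x = x" for x
    using h by (simp_all add: g)

  have inv: "poly g (poly g x) = x" for x
    using cosets[of x]
  proof (elim disjE)
    assume x: "x ^ m = 1"
    then have "(x * u) ^ m = w" by (simp add: power_mult_distrib um)
    then show ?thesis using v x u0 by simp
  next
    assume x: "x ^ m = w"
    then have "(x / u) ^ m = 1" using u0 um by (auto simp: power_divide)
    then show ?thesis using v x u0 by simp
  qed (simp_all add: v)

  have w2_pow: "w ^ (i mod 3) = w\<^sup>2 \<longleftrightarrow> i mod 3 = 2" for i
  proof -
    have "i mod 3 = 0 \<or> i mod 3 = 1 \<or> i mod 3 = 2" by linarith
    then show ?thesis using w2 by (elim disjE) simp_all
  qed
  have "{x. poly g x = x} = insert 0 {x. x ^ m = w\<^sup>2}"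
  proof -
    have "poly g x = x \<longleftrightarrow> x = 0 \<or> x ^ m = w\<^sup>2" for x
      using cosets[of x]
    proof (elim disjE)
      assume x: "x ^ m = 1"
      then show ?thesis using v(2)[OF x] u1 w2 by auto
    next
      assume x: "x ^ m = w"
      then show ?thesis using v(3)[OF x] u0 u1 w2 by (auto simp: field_simps)
    qed (simp_all add: v)
    then show ?thesis by auto
  qed
  \<comment> \<open>Counting the coset becomes counting exponents. Zero lies outside it because
    \<open>m > 0\<close> gives \<open>0 ^ m = 0\<close>, whereas \<open>w ^ 3 = 1\<close> makes
    \<open>w\<^sup>2\<close> nonzero.\<close>
  moreover have "{x. x ^ m = w\<^sup>2} = (\<lambda>i. \<gamma> ^ i) ` {i. i < 3 * m \<and> i mod 3 = 2}"
  proof (intro equalityI subsetI)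
    fix x assume x: "x \<in> {x. x ^ m = w\<^sup>2}"
    then have "x \<noteq> 0" using m w3 by (auto simp: zero_power)
    then obtain i where i: "x = \<gamma> ^ i" "i < 3 * m"
      using bij_betw_imp_surj_on[OF bij] by blast
    then show "x \<in> (\<lambda>i. \<gamma> ^ i) ` {i. i < 3 * m \<and> i mod 3 = 2}"
      using x gamma_pow w2_pow by auto
  qed (auto simp: gamma_pow)
  moreover have "{i. i < 3 * m \<and> i mod 3 = 2} = (\<lambda>j. 3 * j + 2) ` {..<m}"
  proof (intro equalityI subsetI)
    fix i assume "i \<in> {i. i < 3 * m \<and> i mod 3 = 2}"
    then have "i = 3 * (i div 3) + 2" "i div 3 < m" by (simp_all, presburger+)
    then show "i \<in> (\<lambda>j. 3 * j + 2) ` {..<m}" by blast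
  qed (auto, presburger)
  moreover have "card ((\<lambda>i. \<gamma> ^ i) ` {i. i < 3 * m \<and> i mod 3 = 2}) = card {i. i < 3 * m \<and> i mod 3 = 2}"
    by (rule card_image) (rule inj_on_subset[OF bij_betw_imp_inj_on[OF bij]], auto)
  moreover have "card ((\<lambda>j. 3 * j + 2) ` {..<m}) = m"
    by (subst card_image) (auto simp: inj_on_def)
  \<comment> \<open>So the fixed point 0 adds one to the \<open>m\<close> elements of the
    coset.\<close>
  moreover have "(0 :: 'a) \<notin> {x. x ^ m = w\<^sup>2}"
    using m w3 by (auto simp: zero_power)
  ultimately have "card {x. poly g x = x} = m + 1"
    by simp
  moreover have "bij (poly g)"
    by (rule involuntory_imp_bij) (rule inv)
  ultimately show ?thesis
    using inv by (simp add: permutation_poly_def involutory_poly_def)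
qed

end
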